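(* Let $R=k[x_1,\ldots,x_d]$ be a polynomial ring over an infinite field $k$. Let $L$ be an unmixed ideal of $R$ of height $g$, and let $\underline{\beta}\subset L$ be a regular sequence consisting of $g$ monomials. Then $$\mathrm{mono}(L)=(\underline{\beta}):\mathrm{Mono}\big((\underline{\beta}):L\big).$$
   Context: A monomial ideal is an ideal generated by monomials. For an ideal $L$ of $R$, $\mathrm{mono}(L)$ denotes the largest monomial ideal contained in $L$, and $\mathrm{Mono}(L)$ the smallest monomial ideal containing $L$. An ideal $L$ of height $g$ is unmixed if all associated primes of $R/L$ have height $g$. *)

theory Defs
  imports
    "HOL-Library.Poly_Mapping"
    "HOL-Library.Extended_Nat"
begin

section \<open>Ideals of a commutative ring\<close>

lemma module_times: "module ((*) :: 'a::comm_ring_1 \<Rightarrow> 'a \<Rightarrow> 'a)"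
  by unfold_locales (simp_all add: algebra_simps)

text \<open>
  A commutative ring \<open>'a\<close> is a module over itself; its submodules are its ideals.
\<close>

abbreviation is_ideal :: "'a::comm_ring_1 set \<Rightarrow> bool" where
  "is_ideal \<equiv> module.subspace (*)"

abbreviation ideal_gen :: "'a::comm_ring_1 set \<Rightarrow> 'a set" where
  "ideal_gen \<equiv> module.span (*)"

definition prime_ideal :: "'a::comm_ring_1 set \<Rightarrow> bool" where
  "prime_ideal P \<longleftrightarrow> is_ideal P \<and> P \<noteq> UNIV \<and> (\<forall>a b. a * b \<in> P \<longrightarrow> a \<in> P \<or> b \<in> P)"

definition colon :: "'a::comm_ring_1 set \<Rightarrow> 'a set \<Rightarrow> 'a set" where
  "colon I J = {r. \<forall>s\<in>J. r * s \<in> I}"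

text \<open>
  The height of a prime \<open>P\<close> is the supremum of the lengths \<open>n\<close> of the chains
  \<open>P\<^sub>0 \<subset> \<dots> \<subset> P\<^sub>n = P\<close> of prime ideals. The height of an ideal is the infimum of the heights
  of the primes containing it; for the unit ideal it is the infimum of the empty set, i.e.
  \<open>\<infinity>\<close>, so an ideal of finite height is proper.
\<close>

definition prime_height :: "'a::comm_ring_1 set \<Rightarrow> enat" where
  "prime_height P = (SUP n \<in> {n. \<exists>c. (\<forall>i\<le>n. prime_ideal (c i)) \<and>
     (\<forall>i<n. c i \<subset> c (Suc i)) \<and> c n = P}. enat n)"

definition height :: "'a::comm_ring_1 set \<Rightarrow> enat" where
  "height I = (INF P \<in> {P. prime_ideal P \<and> I \<subseteq> P}. prime_height P)"

text \<open>
  The associated primes of the module \<open>R/L\<close>: the annihilator of the residue class of \<open>f\<close> is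
  \<open>{r. r * f \<in> L} = L : {f}\<close>.
\<close>

definition assoc_primes :: "'a::comm_ring_1 set \<Rightarrow> 'a set set" where
  "assoc_primes L = {P. prime_ideal P \<and> (\<exists>f. P = colon L {f})}"

definition unmixed :: "'a::comm_ring_1 set \<Rightarrow> bool" where
  "unmixed L \<longleftrightarrow> is_ideal L \<and> (\<forall>P \<in> assoc_primes L. prime_height P = height L)"

text \<open>
  Each \<open>bs ! i\<close> is a nonzerodivisor modulo the ideal of its predecessors, and the whole
  sequence generates a proper ideal.
\<close>

definition regular_sequence :: "'a::comm_ring_1 list \<Rightarrow> bool" where
  "regular_sequence bs \<longleftrightarrow> ideal_gen (set bs) \<noteq> UNIV \<and>
     (\<forall>i<length bs. \<forall>f. bs ! i * f \<in> ideal_gen (set (take i bs))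
        \<longrightarrow> f \<in> ideal_gen (set (take i bs)))"


section \<open>Monomial ideals of a polynomial ring\<close>

text \<open>
  For a finite type \<open>'n\<close> with \<open>d\<close> elements, \<open>('n, 'k) mpoly_ring\<close> is the polynomial ring
  \<open>k[x\<^sub>1,\<dots>,x\<^sub>d]\<close>: finitely supported maps from exponent vectors to coefficients, with the
  convolution product.
\<close>

type_synonym ('n, 'k) mpoly_ring = "('n \<Rightarrow>\<^sub>0 nat) \<Rightarrow>\<^sub>0 'k"

definition monomials :: "('n, 'k::field) mpoly_ring set" where
  "monomials = range (\<lambda>e. Poly_Mapping.single e 1)"

definition monomial_ideal :: "('n, 'k::field) mpoly_ring set \<Rightarrow> bool" where
  "monomial_ideal I \<longleftrightarrow> (\<exists>S \<subseteq> monomials. I = ideal_gen S)"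

text \<open>
  \<open>mono(L)\<close> and \<open>Mono(L)\<close>. The order on sets is inclusion; that the greatest and the least
  element exist is shown below.
\<close>

definition mono_core :: "('n, 'k::field) mpoly_ring set \<Rightarrow> ('n, 'k) mpoly_ring set" where
  "mono_core L = (GREATEST I. monomial_ideal I \<and> I \<subseteq> L)"

definition Mono_hull :: "('n, 'k::field) mpoly_ring set \<Rightarrow> ('n, 'k) mpoly_ring set" where
  "Mono_hull L = (LEAST I. monomial_ideal I \<and> L \<subseteq> I)"

context
begin

interpretation ideal: module "(*) :: 'a::comm_ring_1 \<Rightarrow> 'a \<Rightarrow> 'a"
  by (rule module_times)

lemma mono_core_greatest:
  fixes L :: "('n, 'k::field) mpoly_ring set"
  assumes L: "is_ideal L"
  shows "monomial_ideal (mono_core L)" "mono_core L \<subseteq> L"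
    and "\<And>I. monomial_ideal I \<Longrightarrow> I \<subseteq> L \<Longrightarrow> I \<subseteq> mono_core L"
proof -
  let ?M = "ideal_gen (monomials \<inter> L)"
  have 1: "monomial_ideal ?M" "?M \<subseteq> L"
    using ideal.span_minimal[OF _ L, of "monomials \<inter> L"]
    by (auto simp: monomial_ideal_def)
  have 2: "I \<subseteq> ?M" if I: "monomial_ideal I" "I \<subseteq> L" for I
  proof -
    obtain S where S: "S \<subseteq> monomials" "I = ideal_gen S"
      using I(1) by (auto simp: monomial_ideal_def)
    have "S \<subseteq> monomials \<inter> L"
      using S I(2) ideal.span_superset[of S] by auto
    thus ?thesis unfolding S(2) by (rule ideal.span_mono)
  qed
  have "mono_core L = ?M"
    unfolding mono_core_def by (rule Greatest_equality) (use 1 2 in auto)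
  thus "monomial_ideal (mono_core L)" "mono_core L \<subseteq> L"
    "\<And>I. monomial_ideal I \<Longrightarrow> I \<subseteq> L \<Longrightarrow> I \<subseteq> mono_core L"
    using 1 2 by simp_all
qed

lemma monomial_ideal_iff:
  fixes I :: "('n, 'k::field) mpoly_ring set"
  shows "monomial_ideal I \<longleftrightarrow>
    is_ideal I \<and> (\<forall>f\<in>I. \<forall>e\<in>Poly_Mapping.keys f. Poly_Mapping.single e 1 \<in> I)"
    (is "_ \<longleftrightarrow> ?R")
proof
  assume "monomial_ideal I"
  then obtain S where S: "S \<subseteq> monomials" and I: "I = ideal_gen S"
    by (auto simp: monomial_ideal_def)
  let ?T = "{f. \<forall>e\<in>Poly_Mapping.keys f. Poly_Mapping.single e 1 \<in> I}"
  have idl: "is_ideal I" unfolding I by simp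
  have "is_ideal ?T"
  proof (rule ideal.subspaceI)
    show "0 \<in> ?T" by simp
    show "x + y \<in> ?T" if "x \<in> ?T" "y \<in> ?T" for x y
      using that Poly_Mapping.keys_add[of x y] by blast
    show "c * x \<in> ?T" if x: "x \<in> ?T" for c x
    proof safe
      fix e assume "e \<in> Poly_Mapping.keys (c * x)"
      then obtain a b where ab: "e = a + b" "b \<in> Poly_Mapping.keys x"
        using Poly_Mapping.keys_mult[of c x] by blast
      have "Poly_Mapping.single e 1 = Poly_Mapping.single a 1 * (Poly_Mapping.single b 1 :: ('n, 'k) mpoly_ring)"
        by (simp add: ab mult_single)
      thus "Poly_Mapping.single e 1 \<in> I"
        using x ab ideal.subspace_scale[OF idl] by auto
    qed
  qed
  moreover have "S \<subseteq> ?T"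
  proof
    fix s assume s: "s \<in> S"
    then obtain e where "s = Poly_Mapping.single e 1" using S by (auto simp: monomials_def)
    thus "s \<in> ?T" using s ideal.span_base[of s S] I by auto
  qed
  ultimately have "I \<subseteq> ?T" unfolding I by (intro ideal.span_minimal)
  thus ?R using idl by auto
next
  assume R: ?R
  hence idl: "is_ideal I" by blast
  have "I \<subseteq> ideal_gen (monomials \<inter> I)"
  proof
    fix f assume f: "f \<in> I"
    have "f = (\<Sum>e\<in>Poly_Mapping.keys f. Poly_Mapping.single e (Poly_Mapping.lookup f e))"
      by (rule poly_mapping_eqI)
        (simp add: lookup_sum lookup_single when_def in_keys_iff)
    also have "\<dots> = (\<Sum>e\<in>Poly_Mapping.keys f.
        Poly_Mapping.single 0 (Poly_Mapping.lookup f e) * Poly_Mapping.single e 1)"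
      by (simp add: mult_single)
    also have "\<dots> \<in> ideal_gen (monomials \<inter> I)"
      using R f by (intro ideal.span_sum ideal.span_scale ideal.span_base) (auto simp: monomials_def)
    finally show "f \<in> ideal_gen (monomials \<inter> I)" .
  qed
  moreover have "ideal_gen (monomials \<inter> I) \<subseteq> I"
    by (rule ideal.span_minimal[OF _ idl]) auto
  ultimately show "monomial_ideal I"
    unfolding monomial_ideal_def by (intro exI[of _ "monomials \<inter> I"]) auto
qed

lemma Mono_hull_least:
  fixes L :: "('n, 'k::field) mpoly_ring set"
  shows "monomial_ideal (Mono_hull L)" "L \<subseteq> Mono_hull L"
    and "\<And>I. monomial_ideal I \<Longrightarrow> L \<subseteq> I \<Longrightarrow> Mono_hull L \<subseteq> I"
proof -
  let ?F = "{I. monomial_ideal I \<and> L \<subseteq> I}"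
  have 1: "monomial_ideal (\<Inter>?F)"
    unfolding monomial_ideal_iff by (auto intro!: ideal.subspace_Inter)
  have "Mono_hull L = \<Inter>?F"
    unfolding Mono_hull_def by (rule Least_equality) (use 1 in auto)
  thus "monomial_ideal (Mono_hull L)" "L \<subseteq> Mono_hull L"
    "\<And>I. monomial_ideal I \<Longrightarrow> L \<subseteq> I \<Longrightarrow> Mono_hull L \<subseteq> I"
    using 1 by auto
qed

end

end

theory Submission
  imports Defs "HOL-Library.FuncSet"
begin

text \<open>
  Let \<open>B = (\<beta>)\<close>. A monomial \<open>m\<close> of \<open>L\<close> multiplies \<open>B : L\<close> into \<open>B\<close>, and \<open>B : m\<close> is a monomial ideal,
  so \<open>m\<close> also multiplies \<open>Mono(B : L)\<close> into \<open>B\<close>. The other inclusion reduces to \<open>B : (B : L) \<subseteq> L\<close>.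

  If \<open>u \<notin> L\<close>, some multiple of \<open>u\<close> has an associated prime \<open>P\<close> of \<open>R/L\<close> as its annihilator modulo
  \<open>L\<close>. A regular sequence of monomials has pairwise disjoint supports, so \<open>P \<supseteq> B\<close> contains \<open>g\<close>
  distinct variables; having height \<open>g\<close>, it is generated by them. Over the domain \<open>D\<close> of
  polynomials in the remaining variables, the \<open>P\<close>-primary component of \<open>B\<close> has the form
  \<open>(x\<^sub>1\<^bsup>a\<^sub>1\<^esup>, \<dots>, x\<^sub>g\<^bsup>a\<^sub>g\<^esup>)\<close>, and the coefficient of \<open>x\<^sub>1\<^bsup>a\<^sub>1-1\<^esup> \<cdots> x\<^sub>g\<^bsup>a\<^sub>g-1\<^esup>\<close> of a product is a perfect pairing
  over the fraction field of \<open>D\<close>. Linear algebra then yields \<open>c\<close> with \<open>c L \<subseteq> B\<close> and \<open>c u \<notin> B\<close>.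
\<close>

interpretation ideal: module "(*) :: 'a::comm_ring_1 \<Rightarrow> 'a \<Rightarrow> 'a"
  by (rule module_times)

declare ideal.scale_scale [simp del] \<comment> \<open>the reverse of \<open>mult.assoc\<close>, with which it loops\<close>

abbreviation (input) "lookup \<equiv> Poly_Mapping.lookup"
abbreviation (input) "keys \<equiv> Poly_Mapping.keys"
abbreviation (input) "single \<equiv> Poly_Mapping.single"
abbreviation (input) monom :: "'a \<Rightarrow> 'a \<Rightarrow>\<^sub>0 'b::zero_neq_one" where
  "monom e \<equiv> Poly_Mapping.single e 1"

section \<open>Coefficients of products\<close>

lemma sum_single_lookup:
  "(\<Sum>e\<in>keys f. single e (lookup f e)) = f"
  by (rule poly_mapping_eqI) (simp add: lookup_sum lookup_single when_def in_keys_iff)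

lemma lookup_times_sum:
  fixes f g :: "'a::comm_monoid_add \<Rightarrow>\<^sub>0 'b::comm_semiring_1"
  shows "lookup (f * g) q =
    (\<Sum>a\<in>keys f. \<Sum>b\<in>keys g. lookup f a * lookup g b when a + b = q)"
proof -
  have "f * g = (\<Sum>a\<in>keys f. single a (lookup f a)) * (\<Sum>b\<in>keys g. single b (lookup g b))"
    by (simp add: sum_single_lookup)
  also have "\<dots> = (\<Sum>a\<in>keys f. \<Sum>b\<in>keys g. single (a + b) (lookup f a * lookup g b))"
    by (simp add: sum_product mult_single)
  finally have "f * g = \<dots>" .
  thus ?thesis by (simp add: lookup_sum lookup_single)
qed

lemma lookup_single_times:
  fixes f :: "'a::cancel_comm_monoid_add \<Rightarrow>\<^sub>0 'b::comm_semiring_1"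
  shows "lookup (single w c * f) (w + k) = c * lookup f k"
proof -
  have "lookup (single w c * f) (w + k) = (\<Sum>b\<in>keys f. c * lookup f b when b = k)"
    by (subst lookup_times_sum) simp
  also have "\<dots> = c * lookup f k"
    by (simp add: when_def in_keys_iff)
  finally show ?thesis .
qed

lemma keys_monom_times:
  fixes f :: "'a::cancel_comm_monoid_add \<Rightarrow>\<^sub>0 'b::comm_semiring_1"
  shows "keys (monom w * f) = (+) w ` keys f"
proof
  show "keys (monom w * f) \<subseteq> (+) w ` keys f"
    using Poly_Mapping.keys_mult[of "monom w" f] by auto
  show "(+) w ` keys f \<subseteq> keys (monom w * f)"
    by (auto simp: in_keys_iff lookup_single_times)
qed

section \<open>Exponent vectors\<close>

text \<open>Divisibility of monomials is spelled as existence of a summand, since \<open>'n\<close>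
  carries no order; the witness is the truncated difference.\<close>

lemma exponent_le_iff:
  fixes a b :: "'n \<Rightarrow>\<^sub>0 nat"
  shows "(\<exists>d. b = a + d) \<longleftrightarrow> (\<forall>t. lookup a t \<le> lookup b t)"
proof
  assume "\<forall>t. lookup a t \<le> lookup b t"
  hence "b = a + (b - a)"
    by (intro poly_mapping_eqI) (simp add: lookup_add lookup_minus)
  thus "\<exists>d. b = a + d" ..
qed (auto simp: lookup_add)

lemma lookup_Abs_finite [simp]:
  fixes h :: "'n::finite \<Rightarrow> 'b::zero"
  shows "lookup (Abs_poly_mapping h) = h"
  by (rule lookup_Abs_poly_mapping) simp

text \<open>Pulling back the linear order of \<open>nat \<Rightarrow>\<^sub>0 nat\<close> along
  \<phi> gives a monomial order without any order on \<open>'n\<close>.\<close>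

lemma exponent_embedding:
  obtains \<phi> :: "('n::finite \<Rightarrow>\<^sub>0 nat) \<Rightarrow> (nat \<Rightarrow>\<^sub>0 nat)"
  where "inj \<phi>" "\<And>a b. \<phi> (a + b) = \<phi> a + \<phi> b"
proof -
  obtain i :: "'n \<Rightarrow> nat" where i: "inj i"
    using finite_imp_inj_to_nat_seg[of "UNIV :: 'n set"] by auto
  define \<phi> where "\<phi> e = (\<Sum>t\<in>UNIV. single (i t) (lookup e t))" for e :: "'n \<Rightarrow>\<^sub>0 nat"
  have l: "lookup (\<phi> e) (i t) = lookup e t" for e t
    by (simp add: \<phi>_def lookup_sum lookup_single when_def inj_eq[OF i])
  have "inj \<phi>"
  proof (rule injI)
    fix a b assume "\<phi> a = \<phi> b"
    thus "a = b" by (intro poly_mapping_eqI) (metis l)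
  qed
  moreover have "\<phi> (a + b) = \<phi> a + \<phi> b" for a b
    by (simp add: \<phi>_def lookup_add single_add sum.distrib)
  ultimately show ?thesis using that by blast
qed

lemma zero_le_exponent: "(0 :: nat \<Rightarrow>\<^sub>0 nat) \<le> a"
proof -
  have "\<not> a < 0" by transfer (simp add: less_fun_def)
  thus ?thesis by simp
qed

section \<open>Dickson's lemma\<close>

lemma nat_seq_mono_subseq:
  fixes x :: "nat \<Rightarrow> nat"
  obtains r :: "nat \<Rightarrow> nat" where "strict_mono r" "mono (\<lambda>n. x (r n))"
proof -
  obtain r :: "nat \<Rightarrow> nat" where r: "strict_mono r" "monoseq (\<lambda>n. x (r n))"
    using seq_monosub[of x] by auto
  show ?thesis
  proof (cases "mono (\<lambda>n. x (r n))")
    case True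
    thus ?thesis using that r by blast
  next
    case False
    hence dec: "x (r n) \<le> x (r m)" if "m \<le> n" for m n
      using r(2) that by (auto simp: monoseq_def mono_def)
    \<comment> \<open>A nonincreasing sequence in \<open>nat\<close> is constant once it attains its
      minimum.\<close>
    obtain N where N: "\<And>n. x (r N) \<le> x (r n)"
      using ex_has_least_nat[of "\<lambda>_. True" _ "\<lambda>n. x (r n)"] by auto
    have "x (r (N + n)) = x (r N)" for n
      using dec[of N "N + n"] N[of "N + n"] by simp
    hence "mono (\<lambda>n. x (r (N + n)))" by (simp add: mono_def)
    moreover have "strict_mono (\<lambda>n. r (N + n))"
      using r(1) by (simp add: strict_mono_def)
    ultimately show ?thesis using that by blast
  qed
qed

text \<open>Subsequences are extracted for one variable after another until every coordinate is
  nondecreasing; the first two terms then serve.\<close>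

theorem Dickson:
  fixes s :: "nat \<Rightarrow> ('n::finite \<Rightarrow>\<^sub>0 nat)"
  obtains i j d where "i < j" "s j = s i + d"
proof -
  have "\<exists>r::nat\<Rightarrow>nat. strict_mono r \<and> (\<forall>t\<in>T. mono (\<lambda>n. lookup (s (r n)) t))" if "finite T" for T
    using that
  proof induction
    case empty
    show ?case by (auto intro!: exI[of _ id] simp: strict_mono_def)
  next
    case (insert t T)
    then obtain r :: "nat \<Rightarrow> nat" where r: "strict_mono r" "\<And>t. t \<in> T \<Longrightarrow> mono (\<lambda>n. lookup (s (r n)) t)"
      by blast
    obtain q :: "nat \<Rightarrow> nat" where q: "strict_mono q" "mono (\<lambda>n. lookup (s (r (q n))) t)"
      by (rule nat_seq_mono_subseq[of "\<lambda>n. lookup (s (r n)) t"])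
    have "mono (\<lambda>n. lookup (s (r (q n))) t')" if "t' \<in> T" for t'
      using r(2)[OF that] strict_mono_mono[OF q(1)] by (simp add: mono_def)
    moreover have "strict_mono (\<lambda>n. r (q n))"
      using r(1) q(1) by (simp add: strict_mono_def)
    ultimately show ?case using q(2) by blast
  qed
  from this[of UNIV] obtain r :: "nat \<Rightarrow> nat" where
    r: "strict_mono r" "\<And>t. mono (\<lambda>n. lookup (s (r n)) t)" by auto
  have "r 0 < r 1" using r(1) by (simp add: strict_mono_def)
  moreover have "\<exists>d. s (r 1) = s (r 0) + d"
    unfolding exponent_le_iff using r(2) by (simp add: mono_def)
  ultimately show ?thesis using that by blast
qed

section \<open>Leading exponents\<close>

text \<open>A relation rather than a function, so that \<open>0\<close> simply has no leading
  exponent. The intended \<phi> is the map of \<open>exponent_embedding\<close>.\<close>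

definition leading :: "('a \<Rightarrow> 'o::linorder) \<Rightarrow> ('a \<Rightarrow>\<^sub>0 'b::zero) \<Rightarrow> 'a \<Rightarrow> bool" where
  "leading \<phi> f e \<longleftrightarrow> e \<in> keys f \<and> (\<forall>k\<in>keys f. \<phi> k \<le> \<phi> e)"

lemma leading_exists:
  assumes "f \<noteq> 0"
  obtains e where "leading \<phi> f e"
proof -
  have ne: "keys f \<noteq> {}" using assms
    by (metis empty_iff lookup_zero poly_mapping_eqI in_keys_iff)
  hence "Max (\<phi> ` keys f) \<in> \<phi> ` keys f" by (intro Max_in) auto
  then obtain e where e: "e \<in> keys f" "\<phi> e = Max (\<phi> ` keys f)" by auto
  have "leading \<phi> f e"
    unfolding leading_def e(2) using e(1) by (auto intro: Max_ge)
  thus ?thesis by (rule that)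
qed

text \<open>Leading terms cannot cancel: only the pair of leading exponents contributes to the
  coefficient at their sum.\<close>

lemma mpoly_no_zero_divisors:
  fixes f g :: "('n::finite, 'k::field) mpoly_ring"
  assumes "f * g = 0"
  shows "f = 0 \<or> g = 0"
proof (rule ccontr)
  assume *: "\<not> ?thesis"
  obtain \<phi> :: "('n \<Rightarrow>\<^sub>0 nat) \<Rightarrow> (nat \<Rightarrow>\<^sub>0 nat)"
    where \<phi>: "inj \<phi>" "\<And>a b. \<phi> (a + b) = \<phi> a + \<phi> b" by (rule exponent_embedding) blast
  obtain a where a: "leading \<phi> f a" using * leading_exists by blast
  obtain b where b: "leading \<phi> g b" using * leading_exists by blast
  have eq: "x + y = a + b \<longleftrightarrow> x = a \<and> y = b" if "x \<in> keys f" "y \<in> keys g" for x y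
  proof
    assume e: "x + y = a + b"
    have le: "\<phi> x \<le> \<phi> a" "\<phi> y \<le> \<phi> b" using a b that by (auto simp: leading_def)
    have s: "\<phi> x + \<phi> y = \<phi> a + \<phi> b" using e \<phi>(2) by metis
    have "\<phi> x = \<phi> a"
    proof (rule ccontr)
      assume "\<phi> x \<noteq> \<phi> a"
      hence "\<phi> x < \<phi> a" using le by simp
      hence "\<phi> x + \<phi> y < \<phi> a + \<phi> b" using le by (intro add_less_le_mono)
      thus False using s by simp
    qed
    thus "x = a \<and> y = b" using e \<phi>(1) by (auto dest: injD)
  qed auto
  have "lookup (f * g) (a + b) =
      (\<Sum>x\<in>keys f. \<Sum>y\<in>keys g. if y = b then (if x = a then lookup f x * lookup g y else 0) else 0)"
    unfolding lookup_times_sum when_def by (intro sum.cong) (auto simp: eq)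
  also have "\<dots> = lookup f a * lookup g b"
    using a b by (simp add: leading_def)
  also have "\<dots> \<noteq> 0" using a b by (simp add: leading_def in_keys_iff)
  finally show False using assms by simp
qed

section \<open>The ascending chain condition\<close>

text \<open>In a descending sequence Dickson's lemma finds a later term that is a multiple of an
  earlier one, hence not smaller.\<close>

lemma wf_exponent_order:
  fixes \<phi> :: "('n::finite \<Rightarrow>\<^sub>0 nat) \<Rightarrow> (nat \<Rightarrow>\<^sub>0 nat)"
  assumes add: "\<And>a b. \<phi> (a + b) = \<phi> a + \<phi> b"
  shows "wf {(a, b). \<phi> a < \<phi> b}"
proof (subst wf_iff_no_infinite_down_chain, rule notI)
  assume "\<exists>s. \<forall>i. (s (Suc i), s i) \<in> {(a, b). \<phi> a < \<phi> b}"
  then obtain s where s: "\<And>i. \<phi> (s (Suc i)) < \<phi> (s i)" by auto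
  obtain i j d where ij: "i < j" "s j = s i + d" by (rule Dickson)
  have "\<phi> (s j) < \<phi> (s i)"
    using ij(1) by (induction rule: less_Suc_induct) (use s less_trans in blast)+
  moreover have "\<phi> (s i) \<le> \<phi> (s j)"
    unfolding ij(2) add by (simp add: add_increasing2 zero_le_exponent)
  ultimately show False by simp
qed

text \<open>Division: subtracting a scalar multiple of \<open>h\<close> lowers the leading exponent
  of \<open>f\<close>, and the order is well-founded.\<close>

lemma ideal_eq_of_leading:
  fixes I J :: "('n::finite, 'k::field) mpoly_ring set"
  assumes \<phi>: "inj \<phi>" "\<And>a b. \<phi> (a + b) = \<phi> a + (\<phi> b :: nat \<Rightarrow>\<^sub>0 nat)"
    and I: "is_ideal I" and J: "is_ideal J" and "I \<subseteq> J"
    and lead: "\<And>f e. f \<in> J \<Longrightarrow> leading \<phi> f e \<Longrightarrow> \<exists>h\<in>I. leading \<phi> h e"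
  shows "J \<subseteq> I"
proof
  have main: "\<forall>f. f \<in> J \<longrightarrow> leading \<phi> f e \<longrightarrow> f \<in> I" for e
    using wf_exponent_order[OF \<phi>(2)]
  proof (induction e rule: wf_induct_rule)
    case (less e)
    show ?case
    proof (intro allI impI)
      fix f assume f: "f \<in> J" "leading \<phi> f e"
      obtain h where h: "h \<in> I" "leading \<phi> h e" using lead[OF f] by blast
      define c where "c = lookup f e / lookup h e"
      have ch: "lookup (single 0 c * h) k = c * lookup h k" for k
        using lookup_single_times[of 0 c h k] by simp
      define f' where "f' = f - single 0 c * h"
      have lk: "lookup f' k = lookup f k - c * lookup h k" for k
        by (simp add: f'_def lookup_minus ch)
      have "single 0 c * h \<in> I" using I h(1) by (rule ideal.subspace_scale)
      moreover from this have f'J: "f' \<in> J"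
        unfolding f'_def using \<open>I \<subseteq> J\<close> f(1) J by (intro ideal.subspace_diff) auto
      have "f' \<in> I"
      proof (cases "f' = 0")
        case True
        thus ?thesis using ideal.subspace_0[OF I] by simp
      next
        case False
        then obtain e' where e': "leading \<phi> f' e'" using leading_exists by blast
        have "lookup f' e = 0" using h(2) by (simp add: lk c_def leading_def in_keys_iff)
        hence "e' \<noteq> e" using e' by (auto simp: leading_def in_keys_iff)
        moreover have "e' \<in> keys f \<or> e' \<in> keys h"
          using e' by (auto simp: leading_def in_keys_iff lk)
        ultimately have "\<phi> e' < \<phi> e"
          using f(2) h(2) \<phi>(1) by (auto simp: leading_def less_le dest: injD)
        thus ?thesis using less f'J e' by blast
      qed
      ultimately have "f' + single 0 c * h \<in> I" by (intro ideal.subspace_add[OF I])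
      thus "f \<in> I" by (simp add: f'_def)
    qed
  qed
  fix f assume "f \<in> J"
  show "f \<in> I"
  proof (cases "f = 0")
    case True
    thus ?thesis using ideal.subspace_0[OF I] by simp
  next
    case False
    then obtain e where "leading \<phi> f e" using leading_exists by blast
    thus ?thesis using main \<open>f \<in> J\<close> by blast
  qed
qed

text \<open>In this form \<open>wfE_min\<close> yields maximal members of families of ideals. Each
  step of a strict chain would bring a new leading exponent; by Dickson's lemma an earlier one
  divides a later one, which is then not new.\<close>

theorem Hilbert_basis:
  "wf {(J, I :: ('n::finite, 'k::field) mpoly_ring set). is_ideal I \<and> is_ideal J \<and> I \<subset> J}"
proof (subst wf_iff_no_infinite_down_chain, rule notI)
  assume "\<exists>F :: nat \<Rightarrow> ('n, 'k) mpoly_ring set.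
    \<forall>i. (F (Suc i), F i) \<in> {(J, I). is_ideal I \<and> is_ideal J \<and> I \<subset> J}"
  then obtain F :: "nat \<Rightarrow> ('n, 'k) mpoly_ring set"
    where "\<forall>i. (F (Suc i), F i) \<in> {(J, I). is_ideal I \<and> is_ideal J \<and> I \<subset> J}" ..
  hence F: "is_ideal (F i)" "F i \<subset> F (Suc i)" for i by auto
  have mono: "F i \<subseteq> F j" if "i \<le> j" for i j
    by (rule lift_Suc_mono_le[of F, OF psubset_imp_subset[OF F(2)] that])
  obtain \<phi> :: "('n \<Rightarrow>\<^sub>0 nat) \<Rightarrow> (nat \<Rightarrow>\<^sub>0 nat)"
    where \<phi>: "inj \<phi>" "\<And>a b. \<phi> (a + b) = \<phi> a + \<phi> b" by (rule exponent_embedding) blast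
  have "\<exists>f e. f \<in> F (Suc i) \<and> leading \<phi> f e \<and> \<not> (\<exists>h\<in>F i. leading \<phi> h e)" for i
    using ideal_eq_of_leading[OF \<phi> F(1)[of i] F(1)[of "Suc i"]] F(2)[of i] by blast
  then obtain f e where fe: "\<And>i. f i \<in> F (Suc i)" "\<And>i. leading \<phi> (f i) (e i)"
    "\<And>i h. h \<in> F i \<Longrightarrow> \<not> leading \<phi> h (e i)" by metis
  obtain i j d where ij: "i < j" "e j = e i + d" by (rule Dickson)
  have "monom d * f i \<in> F j"
    using fe(1)[of i] mono[of "Suc i" j] ij(1) F(1) by (intro ideal.subspace_scale) auto
  moreover have "leading \<phi> (monom d * f i) (e j)"
    using fe(2)[of i] unfolding leading_def keys_monom_times ij(2) add.commute[of "e i"]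
    by (auto simp: \<phi>(2) add_left_mono)
  ultimately show False using fe(3) by blast
qed

section \<open>Associated primes\<close>

lemma ideal_colon:
  assumes I: "is_ideal I"
  shows "is_ideal (colon I J)"
  using I
  by (intro ideal.subspaceI)
     (auto simp: colon_def distrib_right mult.assoc
       intro: ideal.subspace_0 ideal.subspace_add ideal.subspace_scale)

text \<open>A maximal member \<open>P\<close> among the proper colons L : hu is prime: for
  \<open>b\<close> outside \<open>P\<close>, the colon L : bhu is again proper and contains
  \<open>P\<close>, so it equals \<open>P\<close>, and \<open>a * b \<in> P\<close> puts
  \<open>a\<close> into it.\<close>

lemma assoc_prime_exists:
  fixes L :: "('n::finite, 'k::field) mpoly_ring set"
  assumes L: "is_ideal L" and u: "u \<notin> L"
  obtains h where "colon L {h * u} \<in> assoc_primes L"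
proof -
  let ?C = "\<lambda>h. colon L {h * u}"
  let ?F = "{?C h | h. h * u \<notin> L}"
  have "?C 1 \<in> ?F" using u by (auto intro!: exI[of _ 1])
  then obtain P where P: "P \<in> ?F"
    and max: "\<And>J. (J, P) \<in> {(J, I). is_ideal I \<and> is_ideal J \<and> I \<subset> J} \<Longrightarrow> J \<notin> ?F"
    by (rule wfE_min[OF Hilbert_basis]) blast
  obtain h where h: "P = ?C h" "h * u \<notin> L" using P by blast
  have "prime_ideal P"
    unfolding prime_ideal_def
  proof (intro conjI allI impI)
    show idl: "is_ideal P" unfolding h(1) using L by (rule ideal_colon)
    have "1 \<notin> P" using h by (simp add: colon_def)
    thus "P \<noteq> UNIV" by blast
    fix a b assume ab: "a * b \<in> P"
    show "a \<in> P \<or> b \<in> P"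
    proof (rule disjCI)
      assume "b \<notin> P"
      hence b: "(b * h) * u \<notin> L" by (simp add: h(1) colon_def mult.assoc)
      have "P \<subseteq> ?C (b * h)"
      proof
        fix r assume "r \<in> P"
        hence "b * (r * (h * u)) \<in> L" using L by (simp add: h(1) colon_def ideal.subspace_scale)
        thus "r \<in> ?C (b * h)" by (simp add: colon_def mult_ac)
      qed
      moreover have "?C (b * h) \<in> ?F" using b by blast
      ultimately have "?C (b * h) = P" using max idl ideal_colon[OF L] by blast
      moreover have "a \<in> ?C (b * h)" using ab by (simp add: h(1) colon_def mult_ac)
      ultimately show "a \<in> P" by simp
    qed
  qed
  hence "?C h \<in> assoc_primes L" using h(1) by (auto simp: assoc_primes_def)
  thus ?thesis by (rule that)
qed

section \<open>Ideals generated by monomials\<close>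

lemma mem_ideal_gen_monom_iff:
  fixes f :: "('n, 'k::field) mpoly_ring"
  shows "f \<in> ideal_gen (monom ` E) \<longleftrightarrow> (\<forall>k\<in>keys f. \<exists>e\<in>E. \<exists>d. k = e + d)"
proof
  let ?M = "{f :: ('n, 'k) mpoly_ring. \<forall>k\<in>keys f. \<exists>e\<in>E. \<exists>d. k = e + d}"
  have "is_ideal ?M"
  proof (rule ideal.subspaceI)
    show "x + y \<in> ?M" if "x \<in> ?M" "y \<in> ?M" for x y
      using that Poly_Mapping.keys_add[of x y] by blast
    show "c * x \<in> ?M" if x: "x \<in> ?M" for c x
    proof safe
      fix k assume "k \<in> keys (c * x)"
      then obtain a b where ab: "k = a + b" "b \<in> keys x"
        using Poly_Mapping.keys_mult[of c x] by blast
      then obtain e d where "e \<in> E" "b = e + d" using x by blast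
      thus "\<exists>e\<in>E. \<exists>d. k = e + d" using ab
        by (auto intro!: bexI[of _ e] exI[of _ "a + d"] simp: add_ac)
    qed
  qed simp
  moreover have "monom ` E \<subseteq> ?M" by (auto intro!: exI[of _ 0])
  ultimately have "ideal_gen (monom ` E) \<subseteq> ?M" by (intro ideal.span_minimal)
  thus "f \<in> ideal_gen (monom ` E) \<Longrightarrow> \<forall>k\<in>keys f. \<exists>e\<in>E. \<exists>d. k = e + d" by blast
next
  assume *: "\<forall>k\<in>keys f. \<exists>e\<in>E. \<exists>d. k = e + d"
  have "(\<Sum>k\<in>keys f. single k (lookup f k)) \<in> ideal_gen (monom ` E)"
  proof (rule ideal.span_sum)
    fix k assume "k \<in> keys f"
    then obtain e d where e: "e \<in> E" "k = e + d" using * by blast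
    have "single k (lookup f k) = single d (lookup f k) * monom e"
      using e by (simp add: mult_single add.commute)
    also have "\<dots> \<in> ideal_gen (monom ` E)"
      using e by (intro ideal.span_scale ideal.span_base) auto
    finally show "single k (lookup f k) \<in> ideal_gen (monom ` E)" .
  qed
  thus "f \<in> ideal_gen (monom ` E)" by (simp add: sum_single_lookup)
qed

lemma mem_ideal_of_keys:
  fixes f :: "('n, 'k::field) mpoly_ring"
  assumes "is_ideal I" "\<And>k. k \<in> keys f \<Longrightarrow> monom k \<in> I"
  shows "f \<in> I"
proof -
  have "(\<Sum>k\<in>keys f. single k (lookup f k)) \<in> I"
  proof (rule ideal.subspace_sum[OF assms(1)])
    fix k assume "k \<in> keys f"
    hence "single 0 (lookup f k) * monom k \<in> I"
      using assms by (intro ideal.subspace_scale)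
    thus "single k (lookup f k) \<in> I" by (simp add: mult_single)
  qed
  thus ?thesis by (simp add: sum_single_lookup)
qed

text \<open>Multiplication by a monomial shifts the support without cancellation. The condition on
  \<open>J\<close> covers both monomial ideals and a single monomial.\<close>

lemma monomial_ideal_colon:
  fixes I J :: "('n, 'k::field) mpoly_ring set"
  assumes I: "monomial_ideal I" and J: "\<And>s k. s \<in> J \<Longrightarrow> k \<in> keys s \<Longrightarrow> monom k \<in> J"
  shows "monomial_ideal (colon I J)"
  unfolding monomial_ideal_iff
proof (intro conjI ballI)
  have idl: "is_ideal I" using I by (simp add: monomial_ideal_iff)
  thus "is_ideal (colon I J)" by (rule ideal_colon)
  fix f e assume f: "f \<in> colon I J" and e: "e \<in> keys f"
  have "s * monom e \<in> I" if s: "s \<in> J" for s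
  proof (rule mem_ideal_of_keys[OF idl])
    fix q assume "q \<in> keys (s * monom e)"
    hence "q \<in> (+) e ` keys s" by (metis keys_monom_times mult.commute)
    then obtain k where k: "k \<in> keys s" "q = e + k" by blast
    have "f * monom k \<in> I" using f J[OF s k(1)] by (simp add: colon_def)
    hence "monom k * f \<in> I" by (subst mult.commute)
    moreover have "q \<in> keys (monom k * f)"
      using e k(2) by (auto simp: keys_monom_times add.commute)
    ultimately show "monom q \<in> I" using I by (auto simp: monomial_ideal_iff)
  qed
  thus "monom e \<in> colon I J" by (simp add: colon_def mult.commute)
qed

section \<open>Ideals generated by variables\<close>

text \<open>The ideal generated by the variables in \<open>S\<close>, described by supports so that
  membership is a condition on each exponent.\<close>

definition var_ideal :: "'n set \<Rightarrow> ('n, 'k::field) mpoly_ring set" where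
  "var_ideal S = {f. \<forall>e\<in>keys f. \<exists>t\<in>S. lookup e t \<noteq> 0}"

text \<open>The subring of polynomials in the variables outside \<open>S\<close>, kept as a subset
  of the same ring.\<close>

definition free_of :: "'n set \<Rightarrow> ('n, 'k::field) mpoly_ring set" where
  "free_of S = {f. \<forall>e\<in>keys f. \<forall>t\<in>S. lookup e t = 0}"

text \<open>
  With \<open>y\<close> the variables outside \<open>S\<close> and \<open>\<alpha>\<close> supported on \<open>S\<close>, \<open>slice S \<alpha> f\<close> is the coefficient
  in \<open>k[y]\<close> of \<open>x\<^sup>\<alpha>\<close> in \<open>f\<close>, regarded as a polynomial in the variables of \<open>S\<close>.
\<close>

definition slice ::
  "'n set \<Rightarrow> ('n \<Rightarrow>\<^sub>0 nat) \<Rightarrow> ('n, 'k::field) mpoly_ring \<Rightarrow> ('n, 'k) mpoly_ring" where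
  "slice S \<alpha> f = Abs_poly_mapping (\<lambda>k. lookup f (k + \<alpha>) when (\<forall>t\<in>S. lookup k t = 0))"

lemma lookup_slice:
  "lookup (slice S \<alpha> f) k = (lookup f (k + \<alpha>) when (\<forall>t\<in>S. lookup k t = 0))"
proof -
  have "finite ((\<lambda>k. k + \<alpha>) -` keys f)"
    by (intro finite_vimageI) (auto simp: inj_def)
  hence "finite {k. (lookup f (k + \<alpha>) when (\<forall>t\<in>S. lookup k t = 0)) \<noteq> 0}"
    by (rule finite_subset[rotated]) (auto simp: in_keys_iff)
  thus ?thesis unfolding slice_def by (subst lookup_Abs_poly_mapping) auto
qed

lemma slice_add: "slice S \<alpha> (f + g) = slice S \<alpha> f + slice S \<alpha> g"
  by (rule poly_mapping_eqI) (simp add: lookup_slice lookup_add when_add_distrib)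

lemma slice_diff: "slice S \<alpha> (f - g) = slice S \<alpha> f - slice S \<alpha> g"
  by (rule poly_mapping_eqI) (simp add: lookup_slice lookup_minus when_diff_distrib)

lemma slice_0 [simp]: "slice S \<alpha> 0 = 0"
  by (rule poly_mapping_eqI) (simp add: lookup_slice)

lemma slice_sum: "slice S \<alpha> (sum f A) = (\<Sum>a\<in>A. slice S \<alpha> (f a))"
  by (induction A rule: infinite_finite_induct) (simp_all add: slice_add)

lemma slice_free_of: "slice S \<alpha> f \<in> free_of S"
  by (auto simp: free_of_def in_keys_iff lookup_slice)

lemma slice_single_times:
  fixes f :: "('n, 'k::field) mpoly_ring"
  assumes j: "\<And>t. t \<in> S \<Longrightarrow> lookup j t = 0" and \<alpha>: "\<And>t. t \<notin> S \<Longrightarrow> lookup \<alpha> t = 0"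
  shows "slice S \<alpha> (single j c * f) = single j c * slice S \<alpha> f"
proof (rule poly_mapping_eqI)
  fix k
  have outside: "lookup (single j c * h) q = 0" if "\<nexists>d. q = j + d"
    for h :: "('n, 'k) mpoly_ring" and q
    using that Poly_Mapping.keys_mult[of "single j c" h] by (auto simp: in_keys_iff split: if_splits)
  show "lookup (slice S \<alpha> (single j c * f)) k = lookup (single j c * slice S \<alpha> f) k"
  proof (cases "\<exists>d. k = j + d")
    case True
    then obtain d where k: "k = j + d" by blast
    have "lookup (single j c * f) (k + \<alpha>) = c * lookup f (d + \<alpha>)"
      using lookup_single_times[of j c f "d + \<alpha>"] by (simp add: k add.assoc)
    thus ?thesis
      by (simp add: k lookup_single_times lookup_slice lookup_add j when_def)
  next
    case False
    \<comment> \<open>\<open>j\<close> vanishes on \<open>S\<close> and \<alpha> off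
      \<open>S\<close>, so \<open>j\<close> is below \<open>k + \<alpha>\<close> only if it is below
      \<open>k\<close>.\<close>
    have "\<nexists>d. k + \<alpha> = j + d"
    proof
      assume "\<exists>d. k + \<alpha> = j + d"
      hence le: "lookup j t \<le> lookup k t + lookup \<alpha> t" for t
        by (simp add: exponent_le_iff lookup_add)
      have "lookup j t \<le> lookup k t" for t
        using le[of t] j[of t] \<alpha>[of t] by (cases "t \<in> S") auto
      thus False using False by (simp add: exponent_le_iff)
    qed
    thus ?thesis using False by (simp add: outside lookup_slice)
  qed
qed

text \<open>A factor free of \<open>S\<close> leaves the \<open>S\<close>-parts of exponents
  unchanged, so taking a coefficient is linear over \<open>free_of S\<close>.\<close>

lemma slice_times:
  fixes f :: "('n, 'k::field) mpoly_ring"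
  assumes d: "d \<in> free_of S" and \<alpha>: "\<And>t. t \<notin> S \<Longrightarrow> lookup \<alpha> t = 0"
  shows "slice S \<alpha> (d * f) = d * slice S \<alpha> f"
proof -
  have "slice S \<alpha> (single j (lookup d j) * f) = single j (lookup d j) * slice S \<alpha> f"
    if "j \<in> keys d" for j
    using d that \<alpha> by (intro slice_single_times) (auto simp: free_of_def)
  hence "slice S \<alpha> ((\<Sum>j\<in>keys d. single j (lookup d j)) * f)
      = (\<Sum>j\<in>keys d. single j (lookup d j)) * slice S \<alpha> f"
    by (simp add: sum_distrib_right slice_sum)
  thus ?thesis by (simp add: sum_single_lookup)
qed

lemma free_of_zero: "0 \<in> free_of S"
  and free_of_one: "1 \<in> free_of S"
  by (auto simp: free_of_def)

lemma free_of_add: "f \<in> free_of S \<Longrightarrow> g \<in> free_of S \<Longrightarrow> f + g \<in> free_of S"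
  using Poly_Mapping.keys_add[of f g] by (fastforce simp: free_of_def)

lemma free_of_uminus: "f \<in> free_of S \<Longrightarrow> - f \<in> free_of S"
  by (simp add: free_of_def in_keys_iff)

lemma free_of_times: "f \<in> free_of S \<Longrightarrow> g \<in> free_of S \<Longrightarrow> f * g \<in> free_of S"
  using Poly_Mapping.keys_mult[of f g] by (fastforce simp: free_of_def lookup_add)

lemma free_of_var_ideal:
  assumes "f \<in> free_of S" "f \<in> var_ideal S"
  shows "f = 0"
proof -
  have "keys f = {}" using assms by (auto simp: free_of_def var_ideal_def)
  thus ?thesis by (metis sum.empty sum_single_lookup)
qed

section \<open>Primes generated by variables\<close>

lemma ideal_var_ideal: "is_ideal (var_ideal S :: ('n, 'k::field) mpoly_ring set)"
proof (rule ideal.subspaceI)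
  show "0 \<in> (var_ideal S :: ('n, 'k) mpoly_ring set)" by (simp add: var_ideal_def)
  show "x + y \<in> var_ideal S" if "x \<in> var_ideal S" "y \<in> var_ideal S"
    for x y :: "('n, 'k) mpoly_ring"
    using that Poly_Mapping.keys_add[of x y] unfolding var_ideal_def by blast
  show "c * x \<in> var_ideal S" if x: "x \<in> var_ideal S" for c x :: "('n, 'k) mpoly_ring"
    unfolding var_ideal_def
  proof safe
    fix k assume "k \<in> keys (c * x)"
    then obtain a e where k: "k = a + e" "e \<in> keys x"
      using Poly_Mapping.keys_mult[of c x] by blast
    then obtain t where "t \<in> S" "lookup e t \<noteq> 0" using x by (auto simp: var_ideal_def)
    thus "\<exists>t\<in>S. lookup k t \<noteq> 0" using k by (auto simp: lookup_add)
  qed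
qed

text \<open>\<open>slice S 0\<close> sets the variables in \<open>S\<close> to zero and so
  represents the quotient by \<open>free_of S\<close>, which has no zero divisors.\<close>

lemma prime_var_ideal: "prime_ideal (var_ideal S :: ('n::finite, 'k::field) mpoly_ring set)"
  unfolding prime_ideal_def
proof (intro conjI allI impI)
  let ?P = "var_ideal S :: ('n, 'k) mpoly_ring set"
  show idl: "is_ideal ?P" by (rule ideal_var_ideal)
  have "1 \<notin> ?P" by (simp add: var_ideal_def)
  thus "?P \<noteq> UNIV" by blast
  let ?s = "slice S 0"
  have diff: "h - ?s h \<in> ?P" for h
    by (auto simp: var_ideal_def in_keys_iff lookup_minus lookup_slice when_def split: if_splits)
  fix f g :: "('n, 'k) mpoly_ring" assume fg: "f * g \<in> ?P"
  have "f * g - ?s f * ?s g = g * (f - ?s f) + ?s f * (g - ?s g)"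
    by (simp add: algebra_simps)
  also have "\<dots> \<in> ?P"
    by (intro ideal.subspace_add[OF idl] ideal.subspace_scale[OF idl] diff)
  finally have "?s f * ?s g \<in> ?P"
    using ideal.subspace_diff[OF idl fg] by fastforce
  hence "?s f * ?s g = 0"
    by (intro free_of_var_ideal[of _ S] free_of_times slice_free_of)
  hence "?s f = 0 \<or> ?s g = 0" by (rule mpoly_no_zero_divisors)
  thus "f \<in> ?P \<or> g \<in> ?P" using diff[of f] diff[of g] by auto
qed

lemma var_ideal_subset:
  assumes P: "is_ideal P" and S: "\<And>t. t \<in> S \<Longrightarrow> monom (single t 1) \<in> P"
  shows "var_ideal S \<subseteq> (P :: ('n, 'k::field) mpoly_ring set)"
proof
  fix f :: "('n, 'k) mpoly_ring" assume f: "f \<in> var_ideal S"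
  show "f \<in> P"
  proof (rule mem_ideal_of_keys[OF P])
    fix k assume "k \<in> keys f"
    then obtain t where t: "t \<in> S" "lookup k t \<noteq> 0" using f by (auto simp: var_ideal_def)
    hence "\<forall>t'. lookup (single t 1) t' \<le> lookup k t'"
      by (auto simp: lookup_single when_def)
    then obtain d where "k = single t 1 + d" using exponent_le_iff by blast
    hence "monom k = (monom d * monom (single t 1) :: ('n, 'k) mpoly_ring)"
      by (simp add: mult_single add.commute)
    thus "monom k \<in> P" using ideal.subspace_scale[OF P S[OF t(1)]] by simp
  qed
qed

lemma var_ideal_strict:
  assumes "S \<subseteq> S'" "t \<in> S'" "t \<notin> S"
  shows "var_ideal S \<subset> (var_ideal S' :: ('n, 'k::field) mpoly_ring set)"
proof -
  have "var_ideal S \<subseteq> (var_ideal S' :: ('n, 'k) mpoly_ring set)"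
    using assms(1) unfolding var_ideal_def by blast
  moreover have "monom (single t 1) \<in> (var_ideal S' :: ('n, 'k) mpoly_ring set)"
    using assms(2) by (auto simp: var_ideal_def intro!: bexI[of _ t])
  moreover have "monom (single t 1) \<notin> (var_ideal S :: ('n, 'k) mpoly_ring set)"
    using assms(3) by (auto simp: var_ideal_def lookup_single when_def)
  ultimately show ?thesis by blast
qed

text \<open>Induction on the total degree: one variable is split off, and the prime contains it or
  the cofactor.\<close>

lemma prime_contains_variable:
  fixes P :: "('n::finite, 'k::field) mpoly_ring set"
  assumes P: "prime_ideal P" and e: "monom e \<in> P"
  obtains t where "lookup e t \<noteq> 0" "monom (single t 1) \<in> P"
proof -
  have "\<exists>t. lookup e t \<noteq> 0 \<and> monom (single t 1) \<in> P"
    using e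
  proof (induction "\<Sum>t\<in>UNIV. lookup e t" arbitrary: e rule: less_induct)
    case less
    have idl: "is_ideal P" using P by (simp add: prime_ideal_def)
    have "e \<noteq> 0"
    proof
      assume "e = 0"
      hence "x * 1 \<in> P" for x
        using less.prems ideal.subspace_scale[OF idl, of 1 x] by simp
      hence "P = UNIV" by auto
      thus False using P by (simp add: prime_ideal_def)
    qed
    then obtain t where t: "lookup e t \<noteq> 0" by (metis lookup_zero poly_mapping_eqI)
    hence "\<forall>t'. lookup (single t 1) t' \<le> lookup e t'"
      by (auto simp: lookup_single when_def)
    then obtain d where d: "e = single t 1 + d" using exponent_le_iff by blast
    have "monom (single t 1) * monom d \<in> P" using less.prems by (simp add: d mult_single)
    hence "monom (single t 1) \<in> P \<or> monom d \<in> P" using P unfolding prime_ideal_def by blast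
    thus ?case
    proof
      assume "monom d \<in> P"
      moreover have "(\<Sum>t\<in>UNIV. lookup d t) < (\<Sum>t\<in>UNIV. lookup e t)"
        by (simp add: d lookup_add sum.distrib lookup_single when_def)
      ultimately obtain t' where "lookup d t' \<noteq> 0" "monom (single t' 1) \<in> P"
        using less.hyps by blast
      thus ?thesis by (auto simp: d lookup_add)
    qed (use t in blast)
  qed
  thus ?thesis using that by blast
qed

text \<open>Otherwise adjoining the variables one at a time, and then passing to \<open>P\<close>,
  gives a chain of primes of length g + 1.\<close>

lemma prime_eq_var_ideal:
  fixes P :: "('n::finite, 'k::field) mpoly_ring set"
  assumes P: "prime_ideal P" and ht: "prime_height P = enat g"
    and inj: "inj_on t {..<g}" and t: "\<And>i. i < g \<Longrightarrow> monom (single (t i) 1) \<in> P"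
  shows "P = var_ideal (t ` {..<g})"
proof (rule ccontr)
  let ?V = "\<lambda>i. var_ideal (t ` {..<i}) :: ('n, 'k) mpoly_ring set"
  assume ne: "P \<noteq> ?V g"
  have sub: "?V g \<subset> P"
    using ne var_ideal_subset[of P "t ` {..<g}"] P t by (auto simp: prime_ideal_def)
  define c where "c i = (if i \<le> g then ?V i else P)" for i
  have strict: "?V i \<subset> ?V (Suc i)" if "i < g" for i
    using that by (intro var_ideal_strict[of _ _ "t i"]) (auto dest!: inj_onD[OF inj])
  have "Suc g \<in> {n. \<exists>c. (\<forall>i\<le>n. prime_ideal (c i)) \<and> (\<forall>i<n. c i \<subset> c (Suc i)) \<and> c n = P}"
  proof (intro CollectI exI[of _ c] conjI allI impI)
    fix i assume "i < Suc g"
    thus "c i \<subset> c (Suc i)" using strict[of i] sub by (cases "i = g") (auto simp: c_def)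
  qed (auto simp: c_def P prime_var_ideal)
  hence "enat (Suc g) \<le> prime_height P" unfolding prime_height_def by (rule SUP_upper)
  thus False using ht by simp
qed

section \<open>Regular sequences of monomials\<close>

text \<open>If \<open>b i\<close> and \<open>b j\<close> shared a variable, regularity would put the
  cofactor of the j-th monomial in their lcm into the ideal of the predecessors, so some earlier
  \<open>b l\<close> would divide that cofactor.\<close>

lemma regular_sequence_monom:
  fixes b :: "nat \<Rightarrow> ('n \<Rightarrow>\<^sub>0 nat)"
  assumes reg: "regular_sequence (map (\<lambda>i. monom (b i) :: ('n, 'k::field) mpoly_ring) [0..<g])"
  shows "i < g \<Longrightarrow> b i \<noteq> 0"
    and "i < j \<Longrightarrow> j < g \<Longrightarrow> lookup (b i) t = 0 \<or> lookup (b j) t = 0"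
proof -
  let ?m = "\<lambda>e. monom e :: ('n, 'k) mpoly_ring"
  let ?bs = "map (\<lambda>i. ?m (b i)) [0..<g]"
  show nz: "b i \<noteq> 0" if "i < g" for i
  proof
    assume "b i = 0"
    hence "1 \<in> set ?bs" using that by (force simp: image_iff)
    hence "1 \<in> ideal_gen (set ?bs)" by (rule ideal.span_base)
    hence "x * 1 \<in> ideal_gen (set ?bs)" for x by (rule ideal.span_scale)
    hence "ideal_gen (set ?bs) = UNIV" by auto
    thus False using reg by (simp add: regular_sequence_def)
  qed
  have main: "\<forall>i t. i < j \<longrightarrow> j < g \<longrightarrow> lookup (b i) t = 0 \<or> lookup (b j) t = 0" for j
  proof (induction j rule: less_induct)
    case (less j)
    show ?case
    proof (intro allI impI, rule ccontr)
      fix i t assume ij: "i < j" "j < g" and "\<not> (lookup (b i) t = 0 \<or> lookup (b j) t = 0)"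
      hence t: "lookup (b i) t \<noteq> 0" "lookup (b j) t \<noteq> 0" by auto
      have gen: "set (take j ?bs) = ?m ` (b ` {..<j})"
        using ij by (auto simp: take_map image_iff)
      \<comment> \<open>By truncated subtraction \<open>b j + e\<close> is the exponent of the
        lcm.\<close>
      define e where "e = b i - b j"
      have "\<exists>d. b j + e = b i + d"
        unfolding exponent_le_iff by (intro allI) (simp add: e_def lookup_add lookup_minus)
      hence "?m (b j + e) \<in> ideal_gen (set (take j ?bs))"
        unfolding gen mem_ideal_gen_monom_iff using ij by auto
      hence "?bs ! j * ?m e \<in> ideal_gen (set (take j ?bs))"
        using ij by (simp add: mult_single)
      hence "?m e \<in> ideal_gen (set (take j ?bs))"
        using reg ij unfolding regular_sequence_def by auto
      then obtain l d where l: "l < j" "e = b l + d"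
        unfolding gen mem_ideal_gen_monom_iff by auto
      have le: "lookup (b l) t' \<le> lookup (b i) t' - lookup (b j) t'" for t'
        using arg_cong[OF l(2), of "\<lambda>x. lookup x t'"] by (simp add: e_def lookup_minus lookup_add)
      show False
      proof (cases "l = i")
        case True
        thus False using le[of t] t by simp
      next
        case False
        \<comment> \<open>\<open>b l\<close> is nonzero and divides \<open>b i\<close>, so the two
          share a variable, against the induction hypothesis at the larger of \<open>l\<close> and
          \<open>i\<close>.\<close>
        obtain t' where t': "lookup (b l) t' \<noteq> 0"
          using nz[of l] l ij by (metis lookup_zero poly_mapping_eqI less_trans)
        hence "lookup (b i) t' \<noteq> 0" using le[of t'] by auto
        moreover have "l < i \<or> i < l" using False by auto
        ultimately show False using less.IH[OF ij(1)] less.IH[OF l(1)] t' l(1) ij by (metis less_trans)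
      qed
    qed
  qed
  show "lookup (b i) t = 0 \<or> lookup (b j) t = 0" if "i < j" "j < g"
    by (rule main[rule_format, OF that])
qed

section \<open>Local duality\<close>

text \<open>
  This is the separation of a vector from a subspace over the fraction field of \<open>D\<close>, with
  denominators cleared: assumption \<open>sat\<close> says that \<open>f\<close> is not in the span of \<open>N\<close> there.
\<close>

lemma orthogonal_vector:
  fixes D :: "'a::comm_ring_1 set" and N :: "('e \<Rightarrow> 'a) set" and f :: "'e \<Rightarrow> 'a"
  assumes D: "0 \<in> D" "1 \<in> D" "\<And>x y. x \<in> D \<Longrightarrow> y \<in> D \<Longrightarrow> x + y \<in> D"
      "\<And>x. x \<in> D \<Longrightarrow> - x \<in> D" "\<And>x y. x \<in> D \<Longrightarrow> y \<in> D \<Longrightarrow> x * y \<in> D"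
      "\<And>x y. x \<in> D \<Longrightarrow> y \<in> D \<Longrightarrow> x * y = 0 \<Longrightarrow> x = 0 \<or> y = 0"
    and "finite T"
    and N: "N \<noteq> {}" "\<And>n e. n \<in> N \<Longrightarrow> n e \<in> D"
      "\<And>x y n m. x \<in> D \<Longrightarrow> y \<in> D \<Longrightarrow> n \<in> N \<Longrightarrow> m \<in> N \<Longrightarrow> (\<lambda>e. x * n e + y * m e) \<in> N"
    and f: "\<And>e. f e \<in> D"
    and sat: "\<And>s n. s \<in> D \<Longrightarrow> n \<in> N \<Longrightarrow> \<forall>e\<in>T. n e = s * f e \<Longrightarrow> s = 0"
  obtains v where "\<And>e. v e \<in> D" "\<And>n. n \<in> N \<Longrightarrow> (\<Sum>e\<in>T. v e * n e) = 0"
    "(\<Sum>e\<in>T. v e * f e) \<noteq> 0"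
proof -
  have "\<exists>v. (\<forall>e. v e \<in> D) \<and> (\<forall>n\<in>N. (\<Sum>e\<in>T. v e * n e) = 0) \<and> (\<Sum>e\<in>T. v e * f e) \<noteq> 0"
    using \<open>finite T\<close> N f sat
  proof (induction T arbitrary: N f)
    case empty
    then obtain n where "n \<in> N" by blast
    \<comment> \<open>With no coordinates \<open>sat\<close> at \<open>s = 1\<close> gives
      \<open>1 = 0\<close>, so this case cannot occur.\<close>
    hence "(1::'a) = 0" using empty.prems(5)[of 1 n] D(2) by simp
    thus ?case by simp
  next
    case (insert t T)
    note N = insert.prems(1-3) and f = insert.prems(4) and sat = insert.prems(5)
    show ?case
    proof (cases "\<exists>n\<in>N. n t \<noteq> 0")
      case True
      then obtain n0 where n0: "n0 \<in> N" "n0 t \<noteq> 0" by blast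
      \<comment> \<open>Fraction-free Gaussian elimination with pivot \<open>p\<close>: the vectors
        in \<open>N'\<close> and \<open>f'\<close> vanish at \<open>t\<close>, which leaves a
        problem on \<open>T\<close>.\<close>
      define p where "p = n0 t"
      have p: "p \<in> D" "p \<noteq> 0" using N(2) n0 by (auto simp: p_def)
      define N' where "N' = {n\<in>N. n t = 0}"
      define f' where "f' e = p * f e - f t * n0 e" for e
      have red: "(\<lambda>e. p * n e + (- n t) * n0 e) \<in> N'" if n: "n \<in> N" for n
        using N(3)[OF p(1) D(4)[OF N(2)[OF n]] n n0(1)] by (simp add: N'_def p_def)
      have "\<exists>v. (\<forall>e. v e \<in> D) \<and> (\<forall>n\<in>N'. (\<Sum>e\<in>T. v e * n e) = 0) \<and> (\<Sum>e\<in>T. v e * f' e) \<noteq> 0"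
      proof (rule insert.IH)
        show "N' \<noteq> {}" using red n0(1) by blast
        show "n e \<in> D" if "n \<in> N'" for n e using that N(2) by (simp add: N'_def)
        show "(\<lambda>e. x * n e + y * m e) \<in> N'" if "x \<in> D" "y \<in> D" "n \<in> N'" "m \<in> N'" for x y n m
          using that N(3) by (simp add: N'_def)
        show "f' e \<in> D" for e
          using D(3)[OF D(5)[OF p(1) f[of e]] D(4)[OF D(5)[OF f[of t] N(2)[OF n0(1), of e]]]]
          by (simp add: f'_def)
        fix s n assume s: "s \<in> D" "n \<in> N'" "\<forall>e\<in>T. n e = s * f' e"
        \<comment> \<open>A relation for \<open>f'\<close> lifts to one for \<open>f\<close>; the
          multiple of \<open>n0\<close> supplies the coordinate \<open>t\<close>.\<close>
        have "(\<lambda>e. 1 * n e + (s * f t) * n0 e) \<in> N"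
          using s(2) by (intro N(3) D(2) D(5)[OF s(1) f] n0(1)) (simp add: N'_def)
        moreover have "\<forall>e\<in>insert t T. 1 * n e + (s * f t) * n0 e = (s * p) * f e"
          using s(2,3) by (auto simp: N'_def f'_def p_def algebra_simps)
        ultimately have "s * p = 0" using sat[of "s * p"] D(5)[OF s(1) p(1)] by blast
        thus "s = 0" using D(6)[OF s(1) p(1)] p(2) by blast
      qed
      then obtain v' where v': "\<And>e. v' e \<in> D" "\<And>n. n \<in> N' \<Longrightarrow> (\<Sum>e\<in>T. v' e * n e) = 0"
        "(\<Sum>e\<in>T. v' e * f' e) \<noteq> 0" by blast
      define q where "q = (\<Sum>e\<in>T. v' e * n0 e)"
      have qD: "q \<in> D"
        unfolding q_def using \<open>finite T\<close>
        by (induction T) (auto intro: D v'(1) N(2) n0(1))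
      \<comment> \<open>The value \<open>- q\<close> at \<open>t\<close> makes the pairing of
        \<open>v\<close> with \<open>n\<close> equal to that of \<open>v'\<close> with the reduced
        vector; in particular \<open>v\<close> is orthogonal to \<open>n0\<close>.\<close>
      define v where "v e = (if e = t then - q else p * v' e)" for e
      have sum: "(\<Sum>e\<in>insert t T. v e * n e) = (\<Sum>e\<in>T. v' e * (p * n e - n t * n0 e))" for n
      proof -
        have "(\<Sum>e\<in>insert t T. v e * n e) = - q * n t + (\<Sum>e\<in>T. v e * n e)"
          using insert.hyps by (simp add: v_def)
        also have "(\<Sum>e\<in>T. v e * n e) = (\<Sum>e\<in>T. p * v' e * n e)"
          using insert.hyps by (intro sum.cong) (auto simp: v_def)
        finally show ?thesis
          by (simp add: q_def right_diff_distrib sum_subtractf sum_distrib_left sum_distrib_right mult_ac)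
      qed
      have "(\<Sum>e\<in>insert t T. v e * n e) = 0" if "n \<in> N" for n
        unfolding sum using v'(2)[OF red[OF that]] by simp
      moreover have "(\<Sum>e\<in>insert t T. v e * f e) \<noteq> 0"
        unfolding sum using v'(3) by (simp add: f'_def)
      moreover have "v e \<in> D" for e using D qD p v' by (simp add: v_def)
      ultimately show ?thesis by blast
    next
      case False
      hence nt: "n t = 0" if "n \<in> N" for n using that by blast
      show ?thesis
      proof (cases "f t = 0")
        case True
        have "\<exists>v. (\<forall>e. v e \<in> D) \<and> (\<forall>n\<in>N. (\<Sum>e\<in>T. v e * n e) = 0) \<and> (\<Sum>e\<in>T. v e * f e) \<noteq> 0"
          by (rule insert.IH) (use N f sat True nt in auto)
        then obtain v where v: "\<And>e. v e \<in> D" "\<And>n. n \<in> N \<Longrightarrow> (\<Sum>e\<in>T. v e * n e) = 0"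
          "(\<Sum>e\<in>T. v e * f e) \<noteq> 0" by blast
        have "(\<Sum>e\<in>insert t T. v e * n e) = 0" if "n \<in> N" for n
          using insert.hyps v(2)[OF that] nt[OF that] by simp
        thus ?thesis using insert.hyps True v(1,3) by (intro exI[of _ v]) simp
      next
        case False
        have "(\<Sum>e\<in>insert t T. (if e = t then 1 else 0) * h e) = h t" for h :: "'e \<Rightarrow> 'a"
        proof -
          have "(\<Sum>e\<in>insert t T. (if e = t then 1 else 0) * h e)
              = (\<Sum>e\<in>insert t T. if e = t then h e else 0)"
            by (intro sum.cong) auto
          thus ?thesis using insert.hyps by simp
        qed
        thus ?thesis using False nt D(1,2)
          by (intro exI[of _ "\<lambda>e. if e = t then 1 else 0"]) simp
      qed
    qed
  qed
  thus ?thesis using that by blast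
qed

section \<open>The coefficient pairing at a prime generated by variables\<close>

lemma finite_exponents_below:
  "finite {e :: 'n::finite \<Rightarrow>\<^sub>0 nat. \<forall>s. lookup e s \<le> lookup a s}" (is "finite ?T")
proof (rule finite_subset)
  show "?T \<subseteq> Abs_poly_mapping ` (Pi\<^sub>E UNIV (\<lambda>s. {..lookup a s}))"
  proof
    fix e assume "e \<in> ?T"
    hence "e = Abs_poly_mapping (lookup e)" "lookup e \<in> Pi\<^sub>E UNIV (\<lambda>s. {..lookup a s})"
      by (auto intro: poly_mapping_eqI)
    thus "e \<in> Abs_poly_mapping ` (Pi\<^sub>E UNIV (\<lambda>s. {..lookup a s}))" by blast
  qed
qed (intro finite_imageI finite_PiE; simp)

text \<open>The element \<open>u\<close> is independent of \<open>L\<close> over the fraction field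
  of \<open>free_of S\<close>: a relation puts \<open>s * u - l\<close> into \<open>Q\<close>, so
  \<open>x\<^sup>w * s\<close> lies in the prime, and so does \<open>s\<close>, which forces
  \<open>s = 0\<close>. An orthogonal vector then gives \<open>c\<close>, and
  \<open>x\<^sup>w * c\<close> separates.\<close>

lemma colon_separates:
  fixes L :: "('n::finite, 'k::field) mpoly_ring set"
    and b :: "nat \<Rightarrow> ('n \<Rightarrow>\<^sub>0 nat)" and t :: "nat \<Rightarrow> 'n" and g :: nat
  defines "S \<equiv> t ` {..<g}" and "B \<equiv> ideal_gen (monom ` (b ` {..<g}))"
  assumes pos: "\<And>i. i < g \<Longrightarrow> lookup (b i) (t i) \<noteq> 0"
    and disj: "\<And>i j. i < g \<Longrightarrow> j < g \<Longrightarrow> i \<noteq> j \<Longrightarrow> lookup (b j) (t i) = 0"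
    and L: "is_ideal L" and BL: "B \<subseteq> L" and P: "colon L {u} = var_ideal S"
  obtains c where "c \<in> colon B L" "c * u \<notin> B"
proof -
  \<comment> \<open>The exponent of the product of the generators. Its value at \<open>t i\<close>
    is that of \<open>b i\<close>, which is positive, so the subtraction of 1 in \<alpha> does not
    truncate; \<open>w\<close> keeps the part off \<open>S\<close>.\<close>
  define \<beta> where "\<beta> = (\<Sum>i<g. b i)"
  define \<alpha> where "\<alpha> = Abs_poly_mapping (\<lambda>s. if s \<in> S then lookup \<beta> s - 1 else 0)"
  define w where "w = Abs_poly_mapping (\<lambda>s. if s \<in> S then 0 else lookup \<beta> s)"
  \<comment> \<open>\<open>Q = B : x\<^sup>w\<close> is the primary component of \<open>B\<close> at \<open>var_ideal S\<close>\<close>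
  define Q :: "('n, 'k) mpoly_ring set" where
    "Q = {f. \<forall>k\<in>keys f. \<exists>s\<in>S. lookup \<alpha> s < lookup k s}"
  \<comment> \<open>Exponents of a basis, over \<open>free_of S\<close>, of the ring modulo
    \<open>Q\<close>.\<close>
  define T where "T = {e. \<forall>s. lookup e s \<le> lookup \<alpha> s}"
  let ?\<tau> = "slice S \<alpha> :: ('n, 'k) mpoly_ring \<Rightarrow> _"
  let ?x = "\<lambda>e. monom e :: ('n, 'k) mpoly_ring"
  have \<alpha>: "lookup \<alpha> s = (if s \<in> S then lookup \<beta> s - 1 else 0)" for s by (simp add: \<alpha>_def)
  have w: "lookup w s = (if s \<in> S then 0 else lookup \<beta> s)" for s by (simp add: w_def)
  have \<beta>t: "lookup \<beta> (t i) = lookup (b i) (t i)" if "i < g" for i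
  proof -
    have "lookup \<beta> (t i) = (\<Sum>j<g. if j = i then lookup (b i) (t i) else 0)"
      unfolding \<beta>_def lookup_sum by (intro sum.cong) (auto simp: disj that)
    thus ?thesis using that by simp
  qed
  have \<beta>_ge: "lookup (b i) s \<le> lookup \<beta> s" if "i < g" for i s
    unfolding \<beta>_def lookup_sum using that by (intro member_le_sum) auto
  \<comment> \<open>The factor \<open>x\<^sup>w\<close> supplies the part of every generator off
    \<open>S\<close>, so divisibility by \<open>b i\<close> only concerns the variable
    \<open>t i\<close>.\<close>
  have exp: "(\<exists>i\<in>{..<g}. \<exists>d. w + k = b i + d) \<longleftrightarrow> (\<exists>s\<in>S. lookup \<alpha> s < lookup k s)" for k
  proof
    assume "\<exists>i\<in>{..<g}. \<exists>d. w + k = b i + d"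
    then obtain i where i: "i < g" "\<And>s. lookup (b i) s \<le> lookup w s + lookup k s"
      unfolding exponent_le_iff by (auto simp: lookup_add)
    have "t i \<in> S" using i by (simp add: S_def)
    moreover from this have "lookup \<alpha> (t i) < lookup k (t i)"
      using i(2)[of "t i"] pos[OF i(1)] by (simp add: \<alpha> w \<beta>t i(1))
    ultimately show "\<exists>s\<in>S. lookup \<alpha> s < lookup k s" by blast
  next
    assume "\<exists>s\<in>S. lookup \<alpha> s < lookup k s"
    then obtain i where i: "i < g" "lookup \<alpha> (t i) < lookup k (t i)" by (auto simp: S_def)
    have "lookup (b i) s \<le> lookup w s + lookup k s" for s
    proof (cases "s \<in> S")
      case True
      then obtain j where j: "j < g" "s = t j" by (auto simp: S_def)
      show ?thesis
      proof (cases "j = i")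
        case True
        thus ?thesis using i j \<open>s \<in> S\<close> by (auto simp: \<alpha> \<beta>t)
      next
        case False
        thus ?thesis using disj i(1) j by simp
      qed
    next
      case False
      thus ?thesis using \<beta>_ge[OF i(1), of s] by (simp add: w)
    qed
    thus "\<exists>i\<in>{..<g}. \<exists>d. w + k = b i + d"
      unfolding exponent_le_iff using i(1) by (auto simp: lookup_add)
  qed
  have Bw: "?x w * f \<in> B \<longleftrightarrow> f \<in> Q" for f
    unfolding B_def mem_ideal_gen_monom_iff keys_monom_times Q_def by (simp add: exp)
  have \<tau>Q: "?\<tau> f = 0" if "f \<in> Q" for f
  proof (rule poly_mapping_eqI)
    fix k
    show "lookup (?\<tau> f) k = lookup 0 k"
    proof (rule ccontr)
      assume "lookup (?\<tau> f) k \<noteq> lookup 0 k"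
      hence "k + \<alpha> \<in> keys f" "\<forall>s\<in>S. lookup k s = 0"
        by (auto simp: lookup_slice in_keys_iff when_def split: if_splits)
      thus False using that by (auto simp: Q_def lookup_add)
    qed
  qed
  \<comment> \<open>Nondegeneracy of the pairing: \<open>e\<close> complements the
    \<open>S\<close>-part of a suitable exponent of \<open>f\<close> to \<alpha>, and
    \<open>k'\<close> is its part off \<open>S\<close>.\<close>
  have detect: "\<exists>e\<in>T. ?\<tau> (?x e * f) \<noteq> 0" if f: "f \<notin> Q" for f
  proof -
    obtain k where k: "k \<in> keys f" "\<And>s. s \<in> S \<Longrightarrow> lookup k s \<le> lookup \<alpha> s"
      using f by (auto simp: Q_def not_less)
    define e where "e = Abs_poly_mapping (\<lambda>s. if s \<in> S then lookup \<alpha> s - lookup k s else 0)"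
    define k' where "k' = Abs_poly_mapping (\<lambda>s. if s \<in> S then 0 else lookup k s)"
    have "k' + \<alpha> = e + k"
    proof (rule poly_mapping_eqI)
      fix s
      show "lookup (k' + \<alpha>) s = lookup (e + k) s"
        using k(2)[of s] by (cases "s \<in> S") (simp_all add: lookup_add e_def k'_def \<alpha>)
    qed
    hence "lookup (?\<tau> (?x e * f)) k' = lookup f k"
      by (simp add: lookup_slice k'_def lookup_single_times)
    moreover have "lookup f k \<noteq> 0" using k(1) by (simp add: in_keys_iff)
    moreover have "e \<in> T" by (auto simp: T_def e_def)
    ultimately show ?thesis by (metis lookup_zero)
  qed
  have \<tau>_times: "?\<tau> (d * f) = d * ?\<tau> f" if "d \<in> free_of S" for d f
    using that by (rule slice_times) (simp add: \<alpha>)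
  \<comment> \<open>Each element of \<open>L\<close> is represented by its pairings with the basis
    monomials.\<close>
  let ?N = "(\<lambda>l e. ?\<tau> (?x e * l)) ` L"
  obtain v where v: "\<And>e. v e \<in> free_of S"
    "\<And>n. n \<in> ?N \<Longrightarrow> (\<Sum>e\<in>T. v e * n e) = 0" "(\<Sum>e\<in>T. v e * ?\<tau> (?x e * u)) \<noteq> 0"
  proof (rule orthogonal_vector[of "free_of S" T ?N "\<lambda>e. ?\<tau> (?x e * u)"])
    show "finite T" unfolding T_def by (rule finite_exponents_below)
    show "?N \<noteq> {}" using ideal.subspace_0[OF L] by blast
    show "(\<lambda>e. x * n e + y * m e) \<in> ?N"
      if xy: "x \<in> free_of S" "y \<in> free_of S" and nm: "n \<in> ?N" "m \<in> ?N" for x y n m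
    proof -
      obtain l where l: "n = (\<lambda>e. ?\<tau> (?x e * l))" "l \<in> L" using nm(1) by (rule imageE)
      obtain l' where l': "m = (\<lambda>e. ?\<tau> (?x e * l'))" "l' \<in> L" using nm(2) by (rule imageE)
      have "x * n e + y * m e = ?\<tau> (?x e * (x * l + y * l'))" for e
        using xy by (simp add: l l' \<tau>_times[symmetric] slice_add[symmetric] algebra_simps)
      moreover have "x * l + y * l' \<in> L"
        using L l l' by (intro ideal.subspace_add ideal.subspace_scale)
      ultimately show ?thesis by auto
    qed
    fix s n assume s: "s \<in> free_of S" "n \<in> ?N" "\<forall>e\<in>T. n e = s * ?\<tau> (?x e * u)"
    obtain l where l: "n = (\<lambda>e. ?\<tau> (?x e * l))" "l \<in> L" using s(2) by (rule imageE)
    have "?\<tau> (?x e * (s * u - l)) = 0" if "e \<in> T" for e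
    proof -
      have "?\<tau> (?x e * (s * u - l)) = ?\<tau> (s * (?x e * u)) - ?\<tau> (?x e * l)"
        by (simp add: slice_diff[symmetric] algebra_simps)
      also have "\<dots> = 0" using s(3) that l(1) by (simp add: \<tau>_times[OF s(1)])
      finally show ?thesis .
    qed
    hence "s * u - l \<in> Q" using detect by blast
    hence "?x w * (s * u - l) \<in> L" using Bw BL by blast
    hence "?x w * (s * u - l) + ?x w * l \<in> L"
      by (rule ideal.subspace_add[OF L _ ideal.subspace_scale[OF L l(2)]])
    hence "?x w * s \<in> var_ideal S"
      unfolding P[symmetric] by (simp add: colon_def algebra_simps)
    moreover have "?x w \<notin> var_ideal S" by (simp add: var_ideal_def w)
    ultimately have "s \<in> var_ideal S" using prime_var_ideal unfolding prime_ideal_def by blast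
    thus "s = 0" using s(1) free_of_var_ideal by blast
  qed (auto simp: free_of_zero free_of_one free_of_add free_of_uminus free_of_times
         slice_free_of dest: mpoly_no_zero_divisors)
  define c where "c = (\<Sum>e\<in>T. v e * ?x e)"
  have \<tau>c: "?\<tau> (c * f) = (\<Sum>e\<in>T. v e * ?\<tau> (?x e * f))" for f
    unfolding c_def sum_distrib_right slice_sum by (simp add: mult.assoc \<tau>_times v(1))
  have "c * l \<in> Q" if l: "l \<in> L" for l
  proof (rule ccontr)
    assume "c * l \<notin> Q"
    then obtain e where "?\<tau> (?x e * (c * l)) \<noteq> 0" using detect by blast
    \<comment> \<open>\<open>L\<close> is an ideal, so orthogonality applies to
      \<open>x\<^sup>e * l\<close>, and every pairing of \<open>c * l\<close> with the basis
      vanishes.\<close>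
    moreover have "?\<tau> (c * (?x e * l)) = 0"
      unfolding \<tau>c by (rule v(2)[OF imageI[OF ideal.subspace_scale[OF L l]]])
    ultimately show False by (simp add: mult.left_commute)
  qed
  hence "?x w * c \<in> colon B L" using Bw by (simp add: colon_def mult.assoc)
  moreover have "c * u \<notin> Q" using v(3) \<tau>c \<tau>Q by metis
  hence "?x w * c * u \<notin> B" using Bw by (simp add: mult.assoc)
  ultimately show ?thesis by (rule that)
qed

section \<open>The double colon and the equality\<close>

text \<open>For \<open>u\<close> outside \<open>L\<close>, some \<open>h * u\<close> has an
  associated prime as annihilator. Separating \<open>h * u\<close> gives \<open>c\<close> in B : L
  with \<open>c * (h * u)\<close> outside B, although \<open>u * c\<close> lies in B.\<close>

lemma colon_colon_subset:
  fixes L :: "('n::finite, 'k::field) mpoly_ring set"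
    and \<beta> :: "('n, 'k) mpoly_ring list"
  assumes L: "unmixed L" "height L = enat (length \<beta>)"
    and \<beta>: "regular_sequence \<beta>" "set \<beta> \<subseteq> monomials" "set \<beta> \<subseteq> L"
  shows "colon (ideal_gen (set \<beta>)) (colon (ideal_gen (set \<beta>)) L) \<subseteq> L"
proof (rule subsetI, rule ccontr)
  let ?B = "ideal_gen (set \<beta>)" and ?g = "length \<beta>"
  fix u assume u: "u \<in> colon ?B (colon ?B L)" "u \<notin> L"
  have idl: "is_ideal L" using L(1) by (simp add: unmixed_def)
  have "\<exists>e. \<beta> ! i = monom e" if "i < ?g" for i
    using subsetD[OF \<beta>(2) nth_mem[OF that]] by (auto simp: monomials_def)
  then obtain b where b: "\<And>i. i < ?g \<Longrightarrow> \<beta> ! i = monom (b i)" by metis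
  have \<beta>_eq: "\<beta> = map (\<lambda>i. monom (b i)) [0..<?g]"
    by (rule nth_equalityI) (simp_all add: b)
  have set_\<beta>: "set \<beta> = monom ` (b ` {..<?g})"
    by (subst \<beta>_eq) (auto simp: image_iff)
  have disj: "lookup (b i) t = 0 \<or> lookup (b j) t = 0" if "i < ?g" "j < ?g" "i \<noteq> j" for i j t
    using that regular_sequence_monom(2)[of b ?g, where 'k = 'k] \<beta>(1) \<beta>_eq
    by (metis nat_neq_iff)
  obtain h where h: "colon L {h * u} \<in> assoc_primes L"
    using assoc_prime_exists[OF idl u(2)] by blast
  let ?P = "colon L {h * u}"
  have P: "prime_ideal ?P" "prime_height ?P = enat ?g"
    using h L by (auto simp: assoc_primes_def unmixed_def)
  have "monom (b i) \<in> ?P" if "i < ?g" for i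
  proof -
    have "monom (b i) \<in> L" using that b \<beta>(3) by (metis nth_mem subsetD)
    hence "h * u * monom (b i) \<in> L" using idl by (intro ideal.subspace_scale)
    thus ?thesis by (simp add: colon_def mult_ac)
  qed
  hence "\<exists>t. lookup (b i) t \<noteq> 0 \<and> monom (single t 1) \<in> ?P" if "i < ?g" for i
    using prime_contains_variable[OF P(1)] that by metis
  then obtain t where t: "\<And>i. i < ?g \<Longrightarrow> lookup (b i) (t i) \<noteq> 0"
    "\<And>i. i < ?g \<Longrightarrow> monom (single (t i) 1) \<in> ?P" by metis
  have tdisj: "lookup (b j) (t i) = 0" if "i < ?g" "j < ?g" "i \<noteq> j" for i j
    using disj[OF that, of "t i"] t(1)[OF that(1)] by auto
  \<comment> \<open>Disjoint supports make the chosen variables distinct, so their number is the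
    height of the prime.\<close>
  have "inj_on t {..<?g}"
    using t(1) tdisj by (intro inj_onI) (metis lessThan_iff)
  hence Pv: "?P = var_ideal (t ` {..<?g})" using P t(2) by (intro prime_eq_var_ideal)
  have BL: "?B \<subseteq> L" using \<beta>(3) idl by (rule ideal.span_minimal)
  obtain c where c: "c \<in> colon ?B L" "c * (h * u) \<notin> ?B"
    using colon_separates[OF t(1) tdisj idl BL[unfolded set_\<beta>] Pv]
    unfolding set_\<beta> by blast
  have "u * c \<in> ?B" using u(1) c(1) by (simp add: colon_def)
  hence "h * (u * c) \<in> ?B" by (rule ideal.span_scale)
  thus False using c(2) by (simp add: mult_ac)
qed

theorem lemma3p2:
  fixes L :: "('n::finite, 'k::field) mpoly_ring set"
    and \<beta> :: "('n, 'k) mpoly_ring list"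
    and g :: nat
  assumes "infinite (UNIV :: 'k set)"
    and "unmixed L"
    and "height L = enat g"
    and "regular_sequence \<beta>"
    and "length \<beta> = g"
    and "set \<beta> \<subseteq> monomials"
    and "set \<beta> \<subseteq> L"
  shows "mono_core L =
    colon (ideal_gen (set \<beta>)) (Mono_hull (colon (ideal_gen (set \<beta>)) L))"
proof
  let ?B = "ideal_gen (set \<beta>)"
  let ?C = "colon ?B L"
  have idl: "is_ideal L" using assms(2) by (simp add: unmixed_def)
  have B: "monomial_ideal ?B" using assms(6) by (auto simp: monomial_ideal_def)
  have hull: "monomial_ideal (Mono_hull ?C)" "?C \<subseteq> Mono_hull ?C"
    by (rule Mono_hull_least)+
  \<comment> \<open>The second inclusion needs the right side to be monomial: it then lies in
    \<open>mono_core L\<close> once it lies in \<open>L\<close>.\<close>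
  have R: "monomial_ideal (colon ?B (Mono_hull ?C))"
    using hull(1) by (intro monomial_ideal_colon[OF B]) (auto simp: monomial_ideal_iff)
  show "mono_core L \<subseteq> colon ?B (Mono_hull ?C)"
  proof
    fix f assume f: "f \<in> mono_core L"
    show "f \<in> colon ?B (Mono_hull ?C)"
    proof (rule mem_ideal_of_keys)
      show "is_ideal (colon ?B (Mono_hull ?C))" using R by (simp add: monomial_ideal_iff)
      fix k assume "k \<in> keys f"
      hence "monom k \<in> mono_core L"
        using mono_core_greatest(1)[OF idl] f by (auto simp: monomial_ideal_iff)
      hence "monom k \<in> L" using mono_core_greatest(2)[OF idl] by blast
      hence "?C \<subseteq> colon ?B {monom k}" by (auto simp: colon_def)
      moreover have "monomial_ideal (colon ?B {monom k})"
        by (rule monomial_ideal_colon[OF B]) auto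
      ultimately have "Mono_hull ?C \<subseteq> colon ?B {monom k}" by (intro Mono_hull_least(3))
      thus "monom k \<in> colon ?B (Mono_hull ?C)" by (auto simp: colon_def mult.commute)
    qed
  qed
  have "colon ?B (Mono_hull ?C) \<subseteq> colon ?B ?C" using hull(2) by (auto simp: colon_def)
  also have "\<dots> \<subseteq> L" using assms by (intro colon_colon_subset) auto
  finally show "colon ?B (Mono_hull ?C) \<subseteq> mono_core L"
    using R by (intro mono_core_greatest(3)[OF idl])
qed

end
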